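(* Let $H_1,H_2$ be hyperplanes in $Q_{1,1}$ such that $\Psi(H_1)$ and $\Psi(H_2)$ are respectively the graphs over $\mathbb{C}^*$ of the Möbius transformations $\mathcal{M}_{S_1}$ and $\mathcal{M}_{S_2}$, with $S_1,S_2\in SL(2,\mathbb{C})$. Then $H_1$ and $H_2$ are equivalent under the action of $SO^+(3,1)$ if and only if there exists $T\in SL(2,\mathbb{C})$ such that $S_2=\pm\bar TS_1T^{-1}$.
   Context: On $\mathbb{C}^4$ let $\langle z,w\rangle=z_1w_1+z_2w_2+z_3w_3-z_4w_4$ (complex bilinear), restricting to the Minkowski inner product on $\mathbb{R}^4=\mathbb{R}^{3,1}$. $Q_{1,1}=\{[z]\in\mathbb{CP}^3:\langle z,z\rangle=0\}$, $\mathbb{C}^*=\mathbb{C}\cup\{\infty\}$. $\Psi:Q_{1,1}\to\mathbb{C}^*\times\mathbb{C}^*$ is the biholomorphism with inverse $(w_1,w_2)\mapsto[(w_1+w_2,-i(w_1-w_2),1-w_1w_2,1+w_1w_2)]$ for $w_1,w_2\in\mathbb{C}$, $(w_1,\infty)\mapsto[(1,i,-w_1,w_1)]$, $(\infty,w_2)\mapsto[(1,-i,-w_2,w_2)]$, $(\infty,\infty)\mapsto[(0,0,-1,1)]$. A hyperplane in $Q_{1,1}$ is a set $H_A=\{[z]\in Q_{1,1}:\langle A,z\rangle=0\}$ with $[A]\in\mathbb{CP}^3$. $SO^+(3,1)$ is the group of linear isometries $\sigma$ of $\mathbb{R}^{3,1}$ with $\det\sigma=1$ and $(\sigma(0,0,0,1))_4>0$,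 acting on $\mathbb{CP}^3$ (and $Q_{1,1}$) by complex linear extension; $H_1,H_2$ are equivalent if $\sigma(H_1)=H_2$ for some $\sigma\in SO^+(3,1)$. For $S=\begin{pmatrix}a&b\\c&d\end{pmatrix}$, $\mathcal{M}_S(w)=\frac{aw+b}{cw+d}$. $\bar T$ is the entrywise complex conjugate of $T$. *)

theory Defs
  imports "HOL-Analysis.Analysis"
begin

definition vec4 :: "'a \<Rightarrow> 'a \<Rightarrow> 'a \<Rightarrow> 'a \<Rightarrow> 'a ^ 4"
  where "vec4 a b c d = (\<chi> i. if i = 1 then a else if i = 2 then b else if i = 3 then c else d)"

lemma vec4_nth [simp]:
  "vec4 a b c d $ 1 = a" "vec4 a b c d $ 2 = b" "vec4 a b c d $ 3 = c" "vec4 a b c d $ 4 = d"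
  by (simp_all add: vec4_def)

(* Used at type complex for the bilinear form on C^4 and at type real for the Minkowski
   inner product on R^{3,1}; there is no conjugation in either case. *)
definition mink :: "'a::comm_ring_1 ^ 4 \<Rightarrow> 'a ^ 4 \<Rightarrow> 'a"
  where "mink z w = z$1 * w$1 + z$2 * w$2 + z$3 * w$3 - z$4 * w$4"

(* The point [z] of CP^3 is represented by the set of all its homogeneous coordinate vectors. *)
definition cproj :: "complex ^ 4 \<Rightarrow> (complex ^ 4) set"
  where "cproj z = {c *s z | c. c \<noteq> 0}"

lemma cproj_eq_iff: "cproj z = cproj w \<longleftrightarrow> (\<exists>c. c \<noteq> 0 \<and> w = c *s z)"
proof
  assume "cproj z = cproj w"
  moreover have "w \<in> cproj w"
    unfolding cproj_def by (force intro: exI[of _ 1])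
  ultimately show "\<exists>c. c \<noteq> 0 \<and> w = c *s z"
    by (auto simp: cproj_def)
next
  assume "\<exists>c. c \<noteq> 0 \<and> w = c *s z"
  then obtain c where c: "c \<noteq> 0" and w: "w = c *s z" by blast
  have "d *s z = (d / c) *s w" for d
    using c w by (simp add: vector_smult_assoc)
  then show "cproj z = cproj w"
    using c w unfolding cproj_def
    by (auto simp: vector_smult_assoc) (metis c divide_eq_0_iff nonzero_eq_divide_eq)
qed

definition Q11 :: "(complex ^ 4) set set"
  where "Q11 = {cproj z | z. z \<noteq> 0 \<and> mink z z = 0}"

definition hyperplane_of :: "complex ^ 4 \<Rightarrow> (complex ^ 4) set set"
  where "hyperplane_of A = {cproj z | z. z \<noteq> 0 \<and> mink z z = 0 \<and> mink A z = 0}"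

definition is_hyperplane :: "(complex ^ 4) set set \<Rightarrow> bool"
  where "is_hyperplane H \<longleftrightarrow> (\<exists>A. A \<noteq> 0 \<and> H = hyperplane_of A)"

datatype csphere = Fin complex | Infty

fun Psi_inv :: "csphere \<times> csphere \<Rightarrow> (complex ^ 4) set" where
  "Psi_inv (Fin w1, Fin w2) =
     cproj (vec4 (w1 + w2) (- \<i> * (w1 - w2)) (1 - w1 * w2) (1 + w1 * w2))"
| "Psi_inv (Fin w1, Infty) = cproj (vec4 1 \<i> (- w1) w1)"
| "Psi_inv (Infty, Fin w2) = cproj (vec4 1 (- \<i>) (- w2) w2)"
| "Psi_inv (Infty, Infty) = cproj (vec4 0 0 (- 1) 1)"

(* Only meaningful on Q11; see bij_betw_Psi below. *)
definition Psi :: "(complex ^ 4) set \<Rightarrow> csphere \<times> csphere"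
  where "Psi = inv_into UNIV Psi_inv"

lemma vec4_eq_iff:
  "(x :: 'a ^ 4) = y \<longleftrightarrow> x$1 = y$1 \<and> x$2 = y$2 \<and> x$3 = y$3 \<and> x$4 = y$4"
  by (simp add: vec_eq_iff forall_4)

lemma cproj_eqD:
  assumes "cproj z = cproj w"
  obtains k where "k \<noteq> 0" "w$1 + \<i> * w$2 = k * (z$1 + \<i> * z$2)"
    "w$1 - \<i> * w$2 = k * (z$1 - \<i> * z$2)" "w$4 + w$3 = k * (z$4 + z$3)" "w$4 - w$3 = k * (z$4 - z$3)"
  using assms by (auto simp: cproj_eq_iff algebra_simps)

lemma cproj_eqI:
  assumes "k \<noteq> 0" "w$1 = k * z$1" "w$2 = k * z$2" "w$3 = k * z$3" "w$4 = k * z$4"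
  shows "cproj z = cproj w"
  using assms by (auto simp: cproj_eq_iff vec4_eq_iff)

lemma inj_Psi_inv: "inj Psi_inv"
proof (rule injI)
  have ii: "\<i> * (\<i> * x) = - x" for x :: complex
    by (simp flip: mult.assoc)
  fix p q assume eq: "Psi_inv p = Psi_inv q"
  show "p = q"
    using eq
    by (cases p rule: Psi_inv.cases; cases q rule: Psi_inv.cases)
       (auto elim!: cproj_eqD simp: algebra_simps ii)
qed

lemma range_Psi_inv: "range Psi_inv = Q11"
proof
  have "Psi_inv p \<in> Q11" for p
    unfolding Q11_def
    by (cases p rule: Psi_inv.cases)
       (force simp: mink_def vec4_eq_iff algebra_simps intro!: exI)+
  then show "range Psi_inv \<subseteq> Q11" by blast
next
  show "Q11 \<subseteq> range Psi_inv"
  proof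
    fix P assume "P \<in> Q11"
    then obtain z where P: "P = cproj z" and z: "z \<noteq> 0" "mink z z = 0"
      by (auto simp: Q11_def)
    have ii: "\<i> * (\<i> * x) = - x" for x :: complex
      by (simp flip: mult.assoc)
    define s where "s = z$3 + z$4"
    have null: "(z$1 + \<i> * z$2) * (z$1 - \<i> * z$2) = s * (z$4 - z$3)"
      using z(2) by (simp add: s_def mink_def algebra_simps ii)
    show "P \<in> range Psi_inv"
    proof (cases "s = 0")
      case False
      let ?x = "(z$1 + \<i> * z$2) / s" and ?y = "(z$1 - \<i> * z$2) / s"
      have xy: "?x * ?y = (z$4 - z$3) / s"
        unfolding times_divide_times_eq null using False by simp
      have "Psi_inv (Fin ?x, Fin ?y) = cproj z"
        unfolding Psi_inv.simps xy
        by (rule cproj_eqI[of "s / 2"])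
           (use False in \<open>simp_all add: field_simps ii\<close>, simp_all add: s_def algebra_simps)
      then show ?thesis by (metis P rangeI)
    next
      case True
      then have z3: "z$3 = - z$4" by (simp add: s_def eq_neg_iff_add_eq_0)
      consider "z$1 = 0" "z$2 = 0" | "z$1 \<noteq> 0" "z$2 = \<i> * z$1" | "z$1 \<noteq> 0" "z$2 = - \<i> * z$1"
      proof -
        have "z$1 + \<i> * z$2 = 0 \<or> z$1 - \<i> * z$2 = 0"
          using null True by simp
        then have "z$2 = \<i> * z$1 \<or> z$2 = - \<i> * z$1"
        proof
          assume "z$1 + \<i> * z$2 = 0"
          then have "z$1 = - (\<i> * z$2)" by (simp add: eq_neg_iff_add_eq_0)
          then show ?thesis by (simp add: ii)
        next
          assume "z$1 - \<i> * z$2 = 0"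
          then have "z$1 = \<i> * z$2" by simp
          then show ?thesis by (simp add: ii)
        qed
        then show thesis using that by (cases "z$1 = 0") auto
      qed
      then show ?thesis
      proof cases
        case 1
        then have "z$4 \<noteq> 0" using z(1) z3 by (auto simp: vec4_eq_iff)
        then have "Psi_inv (Infty, Infty) = cproj z"
          unfolding Psi_inv.simps using 1 z3 by (intro cproj_eqI[of "z$4"]) auto
        then show ?thesis by (metis P rangeI)
      next
        case 2
        then have "Psi_inv (Fin (z$4 / z$1), Infty) = cproj z"
          unfolding Psi_inv.simps using z3 by (intro cproj_eqI[of "z$1"]) auto
        then show ?thesis by (metis P rangeI)
      next
        case 3
        then have "Psi_inv (Infty, Fin (z$4 / z$1)) = cproj z"
          unfolding Psi_inv.simps using z3 by (intro cproj_eqI[of "z$1"]) auto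
        then show ?thesis by (metis P rangeI)
      qed
    qed
  qed
qed

lemma bij_betw_Psi: "bij_betw Psi Q11 UNIV"
  unfolding Psi_def
  by (metis bij_betw_inv_into inj_Psi_inv inj_on_imp_bij_betw range_Psi_inv)

(* The Moebius transformation of the Riemann sphere induced by an invertible S. *)
fun moebius_map :: "complex ^ 2 ^ 2 \<Rightarrow> csphere \<Rightarrow> csphere" where
  "moebius_map S (Fin w) =
     (if S$2$1 * w + S$2$2 = 0 then Infty
      else Fin (moebius (S$1$1) (S$1$2) (S$2$1) (S$2$2) w))"
| "moebius_map S Infty = (if S$2$1 = 0 then Infty else Fin (S$1$1 / S$2$1))"

definition graph_of :: "(csphere \<Rightarrow> csphere) \<Rightarrow> (csphere \<times> csphere) set"
  where "graph_of f = range (\<lambda>w. (w, f w))"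

definition SL2C :: "(complex ^ 2 ^ 2) set"
  where "SL2C = {S. det S = 1}"

definition cnj_matrix :: "complex ^ 'n ^ 'm \<Rightarrow> complex ^ 'n ^ 'm"
  where "cnj_matrix T = (\<chi> i j. cnj (T$i$j))"

definition SO_plus_31 :: "(real ^ 4 \<Rightarrow> real ^ 4) set"
  where "SO_plus_31 =
    {\<sigma>. linear \<sigma> \<and> (\<forall>x y. mink (\<sigma> x) (\<sigma> y) = mink x y) \<and> det (matrix \<sigma>) = 1
       \<and> \<sigma> (vec4 0 0 0 1) $ 4 > 0}"

(* The complex linear extension of sigma, i.e. sigma (Re z) + i sigma (Im z). *)
definition complexify :: "(real ^ 4 \<Rightarrow> real ^ 4) \<Rightarrow> complex ^ 4 \<Rightarrow> complex ^ 4"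
  where "complexify \<sigma> z =
    (\<chi> k. complex_of_real (\<sigma> (\<chi> j. Re (z$j)) $ k) + \<i> * complex_of_real (\<sigma> (\<chi> j. Im (z$j)) $ k))"

(* The inner image is the action on a single point of CP^3, which is itself a set of vectors. *)
definition act :: "(real ^ 4 \<Rightarrow> real ^ 4) \<Rightarrow> (complex ^ 4) set set \<Rightarrow> (complex ^ 4) set set"
  where "act \<sigma> H = (\<lambda>p. complexify \<sigma> ` p) ` H"

definition equivalent :: "(complex ^ 4) set set \<Rightarrow> (complex ^ 4) set set \<Rightarrow> bool"
  where "equivalent H1 H2 \<longleftrightarrow> (\<exists>\<sigma>\<in>SO_plus_31. act \<sigma> H1 = H2)"

end

theory Submission
  imports Defs
begin

text \<open>Identify $z$ with the matrix \<open>herm z\<close>, whose determinant is $-\langle z,z\rangle$ and which is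
  Hermitian for real $z$. Then $T$ in $SL(2,C)$ acts by $X \mapsto T X T^*$, which gives a surjection
  onto $SO^+(3,1)$. Null vectors are the rank one matrices $v w^t$, and \<open>Psi\<close> reads off
  $([v],[w])$; since $T v w^t T^* = (T v)(\bar T w)^t$, the group acts on the two factors
  by the Moebius transformations of $T$ and $\bar T$. The graph of $S_1$ is thereby mapped to the graph of
  $\bar T S_1 T^{-1}$, and a matrix in $SL(2,C)$ is determined by its Moebius transformation up to sign.\<close>

section \<open>The action of SL(2,C) on Minkowski space\<close>

definition mat2 :: "'a \<Rightarrow> 'a \<Rightarrow> 'a \<Rightarrow> 'a \<Rightarrow> 'a ^ 2 ^ 2"
  where "mat2 a b c d = (\<chi> i j. if i = 1 then (if j = 1 then a else b) else (if j = 1 then c else d))"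

lemma mat2_nth [simp]:
  "mat2 a b c d $ 1 $ 1 = a" "mat2 a b c d $ 1 $ 2 = b"
  "mat2 a b c d $ 2 $ 1 = c" "mat2 a b c d $ 2 $ 2 = d"
  by (simp_all add: mat2_def)

lemma mat2_eq_iff:
  "(X :: 'a ^ 2 ^ 2) = Y \<longleftrightarrow> X$1$1 = Y$1$1 \<and> X$1$2 = Y$1$2 \<and> X$2$1 = Y$2$1 \<and> X$2$2 = Y$2$2"
  by (auto simp: vec_eq_iff forall_2)

lemma matrix_mult_2_nth:
  "((A :: 'a::semiring_1 ^ 2 ^ 2) ** B) $ i $ j = A$i$1 * B$1$j + A$i$2 * B$2$j"
  by (simp add: matrix_matrix_mult_def sum_2)

lemma matrix_vector_mult_2_nth:
  "((A :: 'a::semiring_1 ^ 2 ^ 2) *v x) $ i = A$i$1 * x$1 + A$i$2 * x$2"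
  by (simp add: matrix_vector_mult_def sum_2)

lemma cnj_matrix_nth [simp]: "cnj_matrix T $ i $ j = cnj (T $ i $ j)"
  by (simp add: cnj_matrix_def)

lemma det_cnj_matrix_2: "det (cnj_matrix T :: complex ^ 2 ^ 2) = cnj (det T)"
  by (simp add: det_2)

definition adjoint_matrix :: "complex ^ 'n ^ 'm \<Rightarrow> complex ^ 'm ^ 'n"
  where "adjoint_matrix T = transpose (cnj_matrix T)"

lemma adjoint_matrix_nth [simp]: "adjoint_matrix T $ i $ j = cnj (T $ j $ i)"
  by (simp add: adjoint_matrix_def transpose_def)

lemma adjoint_matrix_mult_2:
  fixes A B :: "complex ^ 2 ^ 2"
  shows "adjoint_matrix (A ** B) = adjoint_matrix B ** adjoint_matrix A"
  by (simp add: mat2_eq_iff matrix_mult_2_nth)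

lemma det_adjoint_matrix_2: "det (adjoint_matrix T :: complex ^ 2 ^ 2) = cnj (det T)"
  by (simp add: det_2)

text \<open>The signs are matched to \<open>Psi_inv\<close>: the vector used in
  \<open>Psi_inv (Fin w1, Fin w2)\<close> is sent to twice the product of the column
  \<open>(w1, 1)\<close> and the row \<open>(w2, 1)\<close>.\<close>

definition herm :: "complex ^ 4 \<Rightarrow> complex ^ 2 ^ 2"
  where "herm z = mat2 (z$4 - z$3) (z$1 + \<i> * z$2) (z$1 - \<i> * z$2) (z$4 + z$3)"

definition unherm :: "complex ^ 2 ^ 2 \<Rightarrow> complex ^ 4"
  where "unherm X = vec4 ((X$1$2 + X$2$1) / 2) (- \<i> * (X$1$2 - X$2$1) / 2)
    ((X$2$2 - X$1$1) / 2) ((X$2$2 + X$1$1) / 2)"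

lemma i_i_mult: "\<i> * (\<i> * x) = - x"
  by (simp flip: mult.assoc)

lemma herm_unherm [simp]: "herm (unherm X) = X"
  by (simp add: herm_def unherm_def mat2_eq_iff field_simps i_i_mult)

lemma unherm_herm [simp]: "unherm (herm z) = z"
  by (simp add: herm_def unherm_def vec4_eq_iff field_simps i_i_mult)

lemma det_herm: "det (herm z) = - mink z z"
  by (simp add: herm_def det_2 mink_def algebra_simps i_i_mult)

definition spin_act :: "complex ^ 2 ^ 2 \<Rightarrow> complex ^ 4 \<Rightarrow> complex ^ 4"
  where "spin_act T z = unherm (T ** herm z ** adjoint_matrix T)"

lemma spin_act_mult: "spin_act (A ** B) z = spin_act A (spin_act B z)"
  by (simp add: spin_act_def adjoint_matrix_mult_2 matrix_mul_assoc)

lemma spin_act_one: "spin_act (mat 1) z = z"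
proof -
  have "adjoint_matrix (mat 1 :: complex ^ 2 ^ 2) = mat 1"
    by (simp add: mat2_eq_iff mat_def)
  then show ?thesis by (simp add: spin_act_def)
qed

lemma spin_act_uminus: "spin_act (- T) z = spin_act T z"
  by (simp add: spin_act_def vec4_eq_iff matrix_mult_2_nth unherm_def field_simps)

lemma spin_act_add: "spin_act T (z + w) = spin_act T z + spin_act T w"
  by (simp add: spin_act_def vec4_eq_iff matrix_mult_2_nth unherm_def herm_def field_simps)

lemma spin_act_scale: "spin_act T (c *s z) = c *s spin_act T z"
  by (simp add: spin_act_def vec4_eq_iff matrix_mult_2_nth unherm_def herm_def field_simps)

lemma mink_polarization:
  fixes x y :: "'a::comm_ring_1 ^ 4"
  shows "2 * mink x y = mink (x + y) (x + y) - mink x x - mink y y"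
  by (simp add: mink_def algebra_simps)

text \<open>Multiplying by \<open>T\<close> and its adjoint does not change the determinant, so the
  quadratic form is preserved; polarization passes to the bilinear form.\<close>

lemma mink_spin_act:
  assumes "det T = 1"
  shows "mink (spin_act T z) (spin_act T w) = mink z w"
proof -
  have sq: "mink (spin_act T z) (spin_act T z) = mink z z" for z
  proof -
    have "- mink (spin_act T z) (spin_act T z) = det (T ** herm z ** adjoint_matrix T)"
      by (simp flip: det_herm add: spin_act_def)
    also have "\<dots> = - mink z z"
      using assms by (simp add: det_mul det_adjoint_matrix_2 det_herm)
    finally show ?thesis by simp
  qed
  have "2 * mink (spin_act T z) (spin_act T w) = 2 * mink z w"
    by (simp add: mink_polarization sq flip: spin_act_add)
  then show ?thesis by simp
qed

section \<open>Restriction to real vectors\<close>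

definition cvec :: "real ^ 'n \<Rightarrow> complex ^ 'n"
  where "cvec x = (\<chi> j. complex_of_real (x $ j))"

lemma cvec_nth [simp]: "cvec x $ j = complex_of_real (x $ j)"
  by (simp add: cvec_def)

lemma cvec_eq_iff [simp]: "cvec x = cvec y \<longleftrightarrow> x = y"
  by (simp add: vec_eq_iff)

lemma mink_cvec: "mink (cvec x) (cvec y) = complex_of_real (mink x y)"
  by (simp add: mink_def)

definition lorentz :: "complex ^ 2 ^ 2 \<Rightarrow> real ^ 4 \<Rightarrow> real ^ 4"
  where "lorentz T x = (\<chi> k. Re (spin_act T (cvec x) $ k))"

text \<open>Real vectors correspond to Hermitian matrices, and these are preserved by
  \<open>T\<close>. Hence taking real parts in \<open>lorentz\<close> discards nothing, and
  identities for \<open>spin_act\<close> descend to \<open>lorentz\<close>.\<close>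

lemma cvec_lorentz: "cvec (lorentz T x) = spin_act T (cvec x)"
proof -
  have "cnj (spin_act T (cvec x) $ k) = spin_act T (cvec x) $ k" for k
    using exhaust_4[of k]
    by (elim disjE)
       (simp_all add: spin_act_def unherm_def matrix_mult_2_nth herm_def field_simps)
  then have "Im (spin_act T (cvec x) $ k) = 0" for k
    by (metis Reals_cnj_iff complex_is_Real_iff)
  then show ?thesis
    by (simp add: vec_eq_iff lorentz_def complex_eq_iff)
qed

lemma lorentz_mult: "lorentz (A ** B) x = lorentz A (lorentz B x)"
  by (metis cvec_eq_iff cvec_lorentz spin_act_mult)

lemma lorentz_one: "lorentz (mat 1) x = x"
  by (metis cvec_eq_iff cvec_lorentz spin_act_one)

lemma lorentz_uminus: "lorentz (- T) = lorentz T"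
  by (simp add: fun_eq_iff lorentz_def spin_act_uminus)

lemma linear_lorentz: "linear (lorentz T)"
proof (rule linearI)
  fix x y :: "real ^ 4" and c :: real
  have "cvec (x + y) = cvec x + cvec y" "cvec (c *\<^sub>R x) = complex_of_real c *s cvec x"
    by (simp_all add: vec_eq_iff)
  then show "lorentz T (x + y) = lorentz T x + lorentz T y"
    and "lorentz T (c *\<^sub>R x) = c *\<^sub>R lorentz T x"
    unfolding lorentz_def by (simp_all only: spin_act_add spin_act_scale) (simp_all add: vec_eq_iff)
qed

lemma mink_lorentz: "det T = 1 \<Longrightarrow> mink (lorentz T x) (lorentz T y) = mink x y"
  by (metis cvec_lorentz mink_cvec mink_spin_act of_real_eq_iff)

text \<open>Both sides are complex linear and agree on real vectors by
  \<open>cvec_lorentz\<close>.\<close>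

lemma complexify_lorentz: "complexify (lorentz T) z = spin_act T z"
proof -
  have "complexify (lorentz T) z
      = cvec (lorentz T (\<chi> j. Re (z $ j))) + \<i> *s cvec (lorentz T (\<chi> j. Im (z $ j)))"
    by (simp add: complexify_def vec_eq_iff)
  also have "\<dots> = spin_act T (cvec (\<chi> j. Re (z $ j)) + \<i> *s cvec (\<chi> j. Im (z $ j)))"
    by (simp only: cvec_lorentz spin_act_add spin_act_scale)
  also have "cvec (\<chi> j. Re (z $ j)) + \<i> *s cvec (\<chi> j. Im (z $ j)) = z"
    by (simp add: vec_eq_iff complex_eq flip: complex_eq)
  finally show ?thesis .
qed

section \<open>Determinant and time orientation\<close>

lemma mink_axis:
  "mink (axis i 1) (axis j 1) = (if i = j then if i = 4 then - 1 else 1 else (0::real))"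
  using exhaust_4[of i] exhaust_4[of j] by (elim disjE) (simp_all add: mink_def axis_def)

text \<open>The Gram matrix \<open>J\<close> of the form is invertible and satisfies
  \<open>transpose M ** J ** M = J\<close>. This leaves the sign of the determinant open.\<close>

lemma det_isometry:
  fixes \<sigma> :: "real ^ 4 \<Rightarrow> real ^ 4"
  assumes iso: "\<And>x y. mink (\<sigma> x) (\<sigma> y) = mink x y"
  shows "(det (matrix \<sigma>))\<^sup>2 = 1"
proof -
  define M :: "real ^ 4 ^ 4" where "M = matrix \<sigma>"
  define J :: "real ^ 4 ^ 4" where "J = (\<chi> i j. mink (axis i 1) (axis j 1))"
  have "det J = (\<Prod>i\<in>UNIV. J $ i $ i)"
    by (rule det_diagonal) (simp add: J_def mink_axis)
  then have "det J \<noteq> 0"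
    by (simp add: J_def mink_axis)
  have "transpose M ** J ** M = J"
  proof -
    have "(transpose M ** J ** M) $ i $ j = mink (\<sigma> (axis i 1)) (\<sigma> (axis j 1))" for i j
      unfolding M_def J_def mink_axis
      by (simp add: matrix_matrix_mult_def transpose_def sum_4 matrix_def mink_def)
    then show ?thesis by (simp add: iso vec_eq_iff J_def)
  qed
  then have "det M * det J * det M = det J"
    by (metis det_mul det_transpose)
  with \<open>det J \<noteq> 0\<close> show ?thesis
    by (simp add: M_def power2_eq_square)
qed

text \<open>By Cayley-Hamilton $(T + 1)^2 = (\mathrm{tr}\, T + 2)\, T$, so $T$ is a square unless its trace
  is $-2$, in which case $-T$ has trace $2$.\<close>
lemma SL2C_square_up_to_sign:
  assumes "det (T :: complex ^ 2 ^ 2) = 1"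
  obtains R where "det R = 1" "T = R ** R \<or> T = - (R ** R)"
proof -
  have root: "\<exists>R. det R = 1 \<and> A = R ** R"
    if A: "det A = 1" and tr: "A$1$1 + A$2$2 + 2 \<noteq> 0" for A :: "complex ^ 2 ^ 2"
  proof -
    define k where "k = csqrt (A$1$1 + A$2$2 + 2)"
    have k2: "k * k = A$1$1 + A$2$2 + 2"
      unfolding k_def by (metis power2_csqrt power2_eq_square)
    then have "k \<noteq> 0" using tr by auto
    define R where "R = mat2 ((A$1$1 + 1) / k) (A$1$2 / k) (A$2$1 / k) ((A$2$2 + 1) / k)"
    have d: "A$1$1 * A$2$2 = 1 + A$1$2 * A$2$1"
      using A by (simp add: det_2 algebra_simps)
    have "det R = (A$1$1 * A$2$2 + A$1$1 + A$2$2 + 1 - A$1$2 * A$2$1) / (k * k)"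
      using \<open>k \<noteq> 0\<close> by (simp add: R_def det_2 field_simps)
    also have "\<dots> = 1" using \<open>k \<noteq> 0\<close> by (simp add: d) (simp add: k2 tr)
    finally have "det R = 1" .
    moreover have "A = R ** R"
      using \<open>k \<noteq> 0\<close> d
      by (simp add: mat2_eq_iff matrix_mult_2_nth R_def)
         (simp add: divide_simps k2, use tr in \<open>simp add: algebra_simps\<close>)
    ultimately show ?thesis by blast
  qed
  show thesis
  proof (cases "T$1$1 + T$2$2 + 2 = 0")
    case False
    then show thesis using root[OF assms] that by blast
  next
    case True
    have "det (- T) = 1" using assms by (simp add: det_2)
    moreover have "(- T)$1$1 + (- T)$2$2 + 2 \<noteq> 0"
    proof -
      have "(- T)$1$1 + (- T)$2$2 + 2 = 4 - (T$1$1 + T$2$2 + 2)" by simp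
      then show ?thesis unfolding True by simp
    qed
    ultimately show thesis using root[of "- T"] that by (metis minus_minus)
  qed
qed

text \<open>The sign is settled by square roots instead of connectedness of the group: up to a sign
  that \<open>lorentz\<close> does not see, \<open>T\<close> is a square, so the determinant is the
  square of a sign.\<close>

lemma det_lorentz:
  assumes "det T = 1"
  shows "det (matrix (lorentz T)) = 1"
proof -
  obtain R where R: "det R = 1" "T = R ** R \<or> T = - (R ** R)"
    using SL2C_square_up_to_sign[OF assms] .
  then have "lorentz T = lorentz R \<circ> lorentz R"
    by (auto simp: lorentz_uminus lorentz_mult)
  then have "det (matrix (lorentz T)) = (det (matrix (lorentz R)))\<^sup>2"
    by (simp add: matrix_compose linear_lorentz det_mul power2_eq_square)
  also have "\<dots> = 1"
    using R(1) by (intro det_isometry mink_lorentz)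
  finally show ?thesis .
qed

lemma lorentz_in_SO_plus:
  assumes "det T = 1"
  shows "lorentz T \<in> SO_plus_31"
proof -
  \<comment> \<open>The time axis corresponds to the identity matrix, so this component is half the
    trace of \<open>T ** adjoint_matrix T\<close>.\<close>
  have "lorentz T (vec4 0 0 0 1) $ 4
      = ((cmod (T$1$1))\<^sup>2 + (cmod (T$1$2))\<^sup>2 + (cmod (T$2$1))\<^sup>2 + (cmod (T$2$2))\<^sup>2) / 2"
    unfolding lorentz_def spin_act_def unherm_def cmod_power2
    by (simp add: matrix_mult_2_nth herm_def power2_eq_square)
  moreover have "T$1$1 \<noteq> 0 \<or> T$1$2 \<noteq> 0"
    using assms by (auto simp: det_2)
  then have "(cmod (T$1$1))\<^sup>2 + (cmod (T$1$2))\<^sup>2 > 0"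
    by (simp add: sum_power2_gt_zero_iff)
  ultimately have "lorentz T (vec4 0 0 0 1) $ 4 > 0"
    by (metis add_pos_nonneg half_gt_zero zero_le_power2)
  then show ?thesis
    by (simp add: SO_plus_31_def linear_lorentz mink_lorentz assms det_lorentz)
qed

lemma matrix_inv_SL2C:
  fixes T :: "complex ^ 2 ^ 2"
  assumes "det T = 1"
  shows "T ** matrix_inv T = mat 1" "matrix_inv T ** T = mat 1" "det (matrix_inv T) = 1"
proof -
  have "invertible T" using assms by (simp add: invertible_det_nz)
  then have *: "T ** matrix_inv T = mat 1 \<and> matrix_inv T ** T = mat 1"
    unfolding invertible_def matrix_inv_def by (rule someI_ex)
  then have "det T * det (matrix_inv T) = 1" by (metis det_I det_mul)
  then show "T ** matrix_inv T = mat 1" "matrix_inv T ** T = mat 1" "det (matrix_inv T) = 1"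
    using * assms by simp_all
qed

section \<open>Surjectivity onto the restricted Lorentz group\<close>

lemma linear_eq_on_basis_4:
  fixes f g :: "real ^ 4 \<Rightarrow> real ^ 4"
  assumes "linear f" "linear g"
    and "f (vec4 1 0 0 0) = g (vec4 1 0 0 0)" "f (vec4 0 1 0 0) = g (vec4 0 1 0 0)"
      "f (vec4 0 0 1 0) = g (vec4 0 0 1 0)" "f (vec4 0 0 0 1) = g (vec4 0 0 0 1)"
  shows "f = g"
proof
  fix x :: "real ^ 4"
  have x: "x = x$1 *\<^sub>R vec4 1 0 0 0 + x$2 *\<^sub>R vec4 0 1 0 0 + x$3 *\<^sub>R vec4 0 0 1 0 + x$4 *\<^sub>R vec4 0 0 0 1"
    by (simp add: vec4_eq_iff)
  show "f x = g x"
    by (subst (1 2) x) (simp add: linear_add linear_scale assms del: vec4_nth)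
qed

text \<open>A null vector with nonnegative time component gives a positive semidefinite Hermitian
  matrix of rank at most one, hence a column \<open>(a, b)\<close> times its adjoint. The three
  equations are the entries of this factorization.\<close>

lemma null_vector_spinor:
  fixes N :: "real ^ 4"
  assumes null: "mink N N = 0" and "N$4 \<ge> 0"
  obtains a b where "a * cnj a = of_real (N$4 - N$3)" "b * cnj b = of_real (N$4 + N$3)"
    "a * cnj b = of_real (N$1) + \<i> * of_real (N$2)"
proof -
  have eq: "(N$1)\<^sup>2 + (N$2)\<^sup>2 = (N$4 - N$3) * (N$4 + N$3)"
    using null by (simp add: mink_def power2_eq_square algebra_simps)
  then have "(N$3)\<^sup>2 \<le> (N$4)\<^sup>2"
    by (simp add: power2_eq_square algebra_simps) (smt (verit) zero_le_square)
  then have "\<bar>N$3\<bar> \<le> N$4" using assms(2) by (metis abs_le_square_iff abs_of_nonneg)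
  then have pos: "N$4 - N$3 \<ge> 0" "N$4 + N$3 \<ge> 0" by auto
  show thesis
  proof (cases "N$4 + N$3 = 0")
    case True
    then have "N$1 = 0" "N$2 = 0" using eq by (auto simp: sum_power2_eq_zero_iff)
    then show thesis
      using True pos
      by (intro that[of "of_real (sqrt (N$4 - N$3))" 0]) (simp_all flip: of_real_mult of_real_add)
  next
    case False
    \<comment> \<open>The common phase of \<open>a\<close> and \<open>b\<close> is free; taking
      \<open>b\<close> real and positive forces the value of \<open>a\<close>.\<close>
    define b where "b = sqrt (N$4 + N$3)"
    have b: "b * b = N$4 + N$3" "b \<noteq> 0" using pos False by (auto simp: b_def)
    define a where "a = Complex (N$1 / b) (N$2 / b)"
    have "(N$1 / b)\<^sup>2 + (N$2 / b)\<^sup>2 = ((N$1)\<^sup>2 + (N$2)\<^sup>2) / (b * b)"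
      by (simp add: power_divide power2_eq_square add_divide_distrib)
    also have "\<dots> = N$4 - N$3" using b False by (simp add: eq)
    finally have "(cmod a)\<^sup>2 = N$4 - N$3" by (simp add: cmod_power2 a_def)
    then have "a * cnj a = of_real (N$4 - N$3)"
      by (metis complex_norm_square)
    moreover have "a * cnj (of_real b) = of_real (N$1) + \<i> * of_real (N$2)"
      using b by (simp add: a_def complex_eq_iff)
    ultimately show thesis
      using b(1) by (intro that[of a "of_real b"]) (simp_all flip: of_real_mult of_real_add)
  qed
qed

text \<open>If \<open>N$4\<close> were nonpositive, Cauchy-Schwarz for the spatial parts
  \<open>a\<close> and \<open>b\<close> would make \<open>mink u N\<close> nonnegative. This puts
  the images of future null vectors in the future cone, where they have spinors.\<close>

lemma future_null:
  fixes u N :: "real ^ 4"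
  assumes u: "mink u u < 0" "u$4 > 0" and N: "mink N N = 0" and uN: "mink u N < 0"
  shows "N$4 > 0"
proof (rule ccontr)
  assume "\<not> N$4 > 0"
  define a b where "a = vec4 (u$1) (u$2) (u$3) 0" and "b = vec4 (N$1) (N$2) (N$3) (0::real)"
  have "(norm a)\<^sup>2 \<le> (u$4)\<^sup>2"
    using u(1) unfolding power2_norm_eq_inner
    by (simp add: inner_vec_def sum_4 a_def mink_def power2_eq_square)
  then have na: "norm a \<le> u$4"
    by (rule power2_le_imp_le) (use u(2) in simp)
  have "(norm b)\<^sup>2 = (- (N$4))\<^sup>2"
    using N unfolding power2_norm_eq_inner
    by (simp add: inner_vec_def sum_4 b_def mink_def power2_eq_square)
  then have nb: "norm b = - (N$4)"
    by (rule power2_eq_imp_eq) (use \<open>\<not> N$4 > 0\<close> in simp_all)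
  have "\<bar>inner a b\<bar> \<le> norm a * norm b" by (rule Cauchy_Schwarz_ineq2)
  also have "\<dots> \<le> u$4 * - (N$4)" unfolding nb
    using na \<open>\<not> N$4 > 0\<close> by (intro mult_right_mono) auto
  finally have "\<bar>inner a b\<bar> \<le> u$4 * - (N$4)" .
  moreover have "mink u N = inner a b - u$4 * N$4"
    by (simp add: mink_def inner_vec_def sum_4 a_def b_def)
  ultimately show False using uN by linarith
qed

lemma lorentz_eqI:
  assumes "T ** herm (cvec x) ** adjoint_matrix T = herm (cvec y)"
  shows "lorentz T x = y"
proof -
  have "cvec (lorentz T x) = cvec y"
    by (simp only: cvec_lorentz spin_act_def assms unherm_herm)
  then show ?thesis by simp
qed

text \<open>The null vectors $(e_4 \mp e_3)/2$ correspond to the two diagonal matrix units, so the columns of the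
  wanted matrix are spinors of the images of these vectors, with one phase adjusted to get determinant 1.\<close>
lemma lorentz_matching_e3_e4:
  assumes "\<sigma> \<in> SO_plus_31"
  obtains T where "det T = 1" "lorentz T (vec4 0 0 1 0) = \<sigma> (vec4 0 0 1 0)"
    "lorentz T (vec4 0 0 0 1) = \<sigma> (vec4 0 0 0 1)"
proof -
  have lin: "linear \<sigma>" and iso: "\<And>x y. mink (\<sigma> x) (\<sigma> y) = mink x y"
    and pos: "\<sigma> (vec4 0 0 0 1) $ 4 > 0"
    using assms by (auto simp: SO_plus_31_def)
  define M N where "M = \<sigma> (vec4 0 0 (- 1/2) (1/2))" and "N = \<sigma> (vec4 0 0 (1/2) (1/2))"
  have null: "mink M M = 0" "mink N N = 0"
    by (simp_all add: M_def N_def iso) (simp_all add: mink_def)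
  have e4: "mink (\<sigma> (vec4 0 0 0 1)) (\<sigma> (vec4 0 0 0 1)) < 0"
    "mink (\<sigma> (vec4 0 0 0 1)) M < 0" "mink (\<sigma> (vec4 0 0 0 1)) N < 0"
    unfolding M_def N_def iso by (simp_all add: mink_def)
  have "M$4 > 0" "N$4 > 0"
    by (rule future_null[OF e4(1) pos null(1) e4(2)], rule future_null[OF e4(1) pos null(2) e4(3)])
  have MN: "mink M N = - 1/2"
    by (simp add: M_def N_def iso) (simp add: mink_def)
  obtain a b where ab: "a * cnj a = of_real (M$4 - M$3)" "b * cnj b = of_real (M$4 + M$3)"
    "a * cnj b = of_real (M$1) + \<i> * of_real (M$2)"
    using null_vector_spinor[OF null(1)] \<open>M$4 > 0\<close> by (metis less_imp_le)
  obtain c d where cd: "c * cnj c = of_real (N$4 - N$3)" "d * cnj d = of_real (N$4 + N$3)"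
    "c * cnj d = of_real (N$1) + \<i> * of_real (N$2)"
    using null_vector_spinor[OF null(2)] \<open>N$4 > 0\<close> by (metis less_imp_le)
  have ba: "b * cnj a = of_real (M$1) - \<i> * of_real (M$2)"
    using arg_cong[OF ab(3), of cnj] by (simp add: mult.commute)
  have dc: "d * cnj c = of_real (N$1) - \<i> * of_real (N$2)"
    using arg_cong[OF cd(3), of cnj] by (simp add: mult.commute)
  define t where "t = a * d - b * c"
  \<comment> \<open>The right-hand side is the polarized determinant of the Hermitian matrices of
    \<open>M\<close> and \<open>N\<close>, which is \<open>- 2 * mink M N\<close>.\<close>
  have "t * cnj t = (a * cnj a) * (d * cnj d) + (b * cnj b) * (c * cnj c)
      - (a * cnj b) * (d * cnj c) - (b * cnj a) * (c * cnj d)"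
    by (simp add: t_def algebra_simps)
  also have "\<dots> = of_real (- 2 * mink M N)"
    by (simp add: ab cd ba dc mink_def algebra_simps i_i_mult)
  finally have t: "t * cnj t = 1" by (simp add: MN)
  then have "t \<noteq> 0" by auto
  \<comment> \<open>As \<open>t\<close> has modulus 1, dividing the second column by it makes the
    determinant 1 and keeps the null vector \<open>N\<close> of that column.\<close>
  have phase: "x / t * cnj (y / t) = x * cnj y" for x y
    using t by simp
  define T where "T = mat2 a (c / t) b (d / t)"
  have "det T = t / t"
    by (simp add: T_def det_2 mult.commute flip: t_def diff_divide_distrib)
  then have "det T = 1" using \<open>t \<noteq> 0\<close> by simp
  moreover have TM: "lorentz T (vec4 0 0 (- 1/2) (1/2)) = M"
    by (rule lorentz_eqI)
       (simp add: T_def mat2_eq_iff matrix_mult_2_nth herm_def ab ba)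
  moreover have TN: "lorentz T (vec4 0 0 (1/2) (1/2)) = N"
    using phase[of c c] phase[of d d] phase[of c d] phase[of d c]
    by (intro lorentz_eqI) (simp add: T_def mat2_eq_iff matrix_mult_2_nth herm_def cd dc)
  moreover have "vec4 0 0 1 0 = vec4 0 0 (1/2) (1/2) - vec4 0 0 (- 1/2) (1/2 :: real)"
    "vec4 0 0 0 1 = vec4 0 0 (1/2) (1/2) + vec4 0 0 (- 1/2) (1/2 :: real)"
    by (simp_all add: vec4_eq_iff)
  ultimately show thesis
    by (intro that[of T]) (simp_all only: linear_add[OF linear_lorentz] linear_add[OF lin]
        linear_diff[OF linear_lorentz] linear_diff[OF lin] TM TN M_def N_def)
qed

text \<open>Half-angle formula: the diagonal matrix with entries \<open>k\<close> and
  \<open>cnj k\<close>, where \<open>k * k\<close> is x + iy, fixes the diagonal of a Hermitian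
  matrix and multiplies its upper right entry by x + iy.\<close>

lemma rotation_lorentz:
  fixes x y :: real
  assumes "x\<^sup>2 + y\<^sup>2 = 1"
  obtains D where "det D = 1"
    "lorentz D (vec4 1 0 0 0) = vec4 x y 0 0" "lorentz D (vec4 0 1 0 0) = vec4 (- y) x 0 0"
    "lorentz D (vec4 0 0 1 0) = vec4 0 0 1 0" "lorentz D (vec4 0 0 0 1) = vec4 0 0 0 1"
proof -
  define k where "k = csqrt (Complex x y)"
  have k2: "k * k = Complex x y"
    unfolding k_def by (metis power2_csqrt power2_eq_square)
  have "(cmod k)\<^sup>2 = 1"
    using assms by (metis complex_norm k2 norm_mult power2_eq_square real_sqrt_one)
  then have kk: "k * cnj k = 1" by (simp flip: complex_norm_square)
  have "cnj k * cnj k = cnj (Complex x y)" by (metis complex_cnj_mult k2)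
  also have "\<dots> = Complex x (- y)" by (simp add: complex_eq_iff)
  finally have ck2: "cnj k * cnj k = Complex x (- y)" .
  define D where "D = mat2 k 0 0 (cnj k)"
  have act: "D ** X ** adjoint_matrix D = mat2 (X$1$1) (Complex x y * X$1$2) (Complex x (- y) * X$2$1) (X$2$2)" for X
  proof -
    have "k * z * cnj k = z" "cnj k * z * k = z"
      "k * z * k = Complex x y * z" "cnj k * z * cnj k = Complex x (- y) * z" for z
      using kk k2 ck2 by algebra+
    then show ?thesis by (simp add: D_def mat2_eq_iff matrix_mult_2_nth)
  qed
  show thesis
  proof
    show "det D = 1" using kk by (simp add: D_def det_2)
  qed (rule lorentz_eqI, simp add: act mat2_eq_iff herm_def complex_eq_iff)+
qed

text \<open>Undoing the images of e3 and e4 by a spin matrix leaves an isometry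
  \<open>\<tau>\<close> that fixes both. It acts on their orthogonal plane, and determinant 1 makes
  it a rotation there.\<close>

lemma SO_plus_is_lorentz:
  assumes "\<sigma> \<in> SO_plus_31"
  obtains T where "det T = 1" "\<sigma> = lorentz T"
proof -
  have lin: "linear \<sigma>" and iso: "\<And>x y. mink (\<sigma> x) (\<sigma> y) = mink x y" and det: "det (matrix \<sigma>) = 1"
    using assms by (auto simp: SO_plus_31_def)
  obtain T where T: "det T = 1" "lorentz T (vec4 0 0 1 0) = \<sigma> (vec4 0 0 1 0)"
    "lorentz T (vec4 0 0 0 1) = \<sigma> (vec4 0 0 0 1)"
    using lorentz_matching_e3_e4[OF assms] .
  define T' where "T' = matrix_inv T"
  have inv: "T ** T' = mat 1" "T' ** T = mat 1"
    and "det T' = 1"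
    using T(1) unfolding T'_def by (rule matrix_inv_SL2C)+
  define \<tau> where "\<tau> = lorentz T' \<circ> \<sigma>"
  have lin': "linear \<tau>" unfolding \<tau>_def by (intro linear_compose lin linear_lorentz)
  have iso': "mink (\<tau> x) (\<tau> y) = mink x y" for x y
    by (simp add: \<tau>_def mink_lorentz \<open>det T' = 1\<close> iso)
  have det': "det (matrix \<tau>) = 1"
    unfolding \<tau>_def by (simp add: matrix_compose lin linear_lorentz det_mul det det_lorentz \<open>det T' = 1\<close>)
  have \<tau>34: "\<tau> (vec4 0 0 1 0) = vec4 0 0 1 0" "\<tau> (vec4 0 0 0 1) = vec4 0 0 0 1"
    by (simp_all add: \<tau>_def inv lorentz_one flip: T(2,3) lorentz_mult)
  define x y where "x = \<tau> (vec4 1 0 0 0)" and "y = \<tau> (vec4 0 1 0 0)"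
  have orth: "mink x x = 1" "mink y y = 1" "mink x y = 0"
    by (simp_all add: x_def y_def iso') (simp_all add: mink_def)
  have x34: "x$3 = 0" "x$4 = 0"
    using iso'[of "vec4 1 0 0 0" "vec4 0 0 1 0"] iso'[of "vec4 1 0 0 0" "vec4 0 0 0 1"]
    unfolding \<tau>34 x_def[symmetric] by (simp_all add: mink_def)
  have y34: "y$3 = 0" "y$4 = 0"
    using iso'[of "vec4 0 1 0 0" "vec4 0 0 1 0"] iso'[of "vec4 0 1 0 0" "vec4 0 0 0 1"]
    unfolding \<tau>34 y_def[symmetric] by (simp_all add: mink_def)
  have xx: "(x$1)\<^sup>2 + (x$2)\<^sup>2 = 1" and yy: "(y$1)\<^sup>2 + (y$2)\<^sup>2 = 1"
    and xy: "x$1 * y$1 + x$2 * y$2 = 0"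
    using orth by (simp_all add: mink_def x34 y34 power2_eq_square)
  \<comment> \<open>\<open>e\<close> is the determinant of \<open>\<tau>\<close> on the plane;
    \<open>y\<close> is \<open>e\<close> times the quarter turn of \<open>x\<close>.\<close>
  define e where "e = x$1 * y$2 - x$2 * y$1"
  have y1: "y$1 = - e * x$2" and y2: "y$2 = e * x$1"
    using xx xy unfolding e_def by algebra+
  have "e\<^sup>2 = 1"
    using xx yy unfolding y1 y2 by algebra
  obtain D where D: "det D = 1"
    "lorentz D (vec4 1 0 0 0) = vec4 (x$1) (x$2) 0 0" "lorentz D (vec4 0 1 0 0) = vec4 (- (x$2)) (x$1) 0 0"
    "lorentz D (vec4 0 0 1 0) = vec4 0 0 1 0" "lorentz D (vec4 0 0 0 1) = vec4 0 0 0 1"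
    using rotation_lorentz[OF xx] .
  \<comment> \<open>For \<open>e = - 1\<close> this is a reflection, so \<open>\<tau>\<close>
    factors as a rotation after \<open>F\<close> before the sign is known; comparing determinants
    then gives \<open>e = 1\<close>.\<close>
  define F :: "real ^ 4 \<Rightarrow> real ^ 4" where "F v = vec4 (v$1) (e * v$2) (v$3) (v$4)" for v
  have linF: "linear F"
    by (rule linearI) (simp_all add: F_def vec4_eq_iff algebra_simps)
  have "det (matrix F) = (\<Prod>i\<in>UNIV. matrix F $ i $ i)"
  proof (rule det_diagonal)
    fix i j :: 4 assume "i \<noteq> j"
    then show "matrix F $ i $ j = 0"
      using exhaust_4[of i] exhaust_4[of j]
      by (elim disjE) (simp_all add: matrix_def F_def axis_def)
  qed
  then have detF: "det (matrix F) = e"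
    unfolding UNIV_4 by (simp add: matrix_def F_def axis_def)
  have "\<tau> = lorentz D \<circ> F"
  proof (rule linear_eq_on_basis_4)
    show "linear \<tau>" "linear (lorentz D \<circ> F)"
      by (intro lin' linear_compose linF linear_lorentz)+
    have F: "F (vec4 1 0 0 0) = vec4 1 0 0 0" "F (vec4 0 1 0 0) = e *\<^sub>R vec4 0 1 0 0"
      "F (vec4 0 0 1 0) = vec4 0 0 1 0" "F (vec4 0 0 0 1) = vec4 0 0 0 1"
      by (simp_all add: F_def vec4_eq_iff)
    show "\<tau> (vec4 1 0 0 0) = (lorentz D \<circ> F) (vec4 1 0 0 0)"
      unfolding x_def[symmetric] comp_def F D by (simp add: vec4_eq_iff x34)
    show "\<tau> (vec4 0 1 0 0) = (lorentz D \<circ> F) (vec4 0 1 0 0)"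
      unfolding y_def[symmetric] comp_def F linear_scale[OF linear_lorentz] D
      by (simp add: vec4_eq_iff y34 y1 y2)
    show "\<tau> (vec4 0 0 1 0) = (lorentz D \<circ> F) (vec4 0 0 1 0)" "\<tau> (vec4 0 0 0 1) = (lorentz D \<circ> F) (vec4 0 0 0 1)"
      unfolding comp_def F D \<tau>34 by (rule refl)+
  qed
  then have "e = 1"
    using det' detF by (simp add: matrix_compose linF linear_lorentz det_mul det_lorentz D(1))
  then have "F = id" by (simp add: F_def fun_eq_iff vec4_eq_iff)
  with \<open>\<tau> = lorentz D \<circ> F\<close> have "\<tau> = lorentz D" by simp
  then have "lorentz T (lorentz T' (\<sigma> v)) = lorentz T (lorentz D v)" for v
    by (simp add: \<tau>_def fun_eq_iff)
  then have "\<sigma> = lorentz (T ** D)"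
    by (simp add: fun_eq_iff lorentz_one inv flip: lorentz_mult)
  moreover have "det (T ** D) = 1" by (simp add: det_mul T D)
  ultimately show thesis using that by blast
qed

section \<open>Moebius transformations in homogeneous coordinates\<close>

fun hom_coords :: "csphere \<Rightarrow> complex ^ 2" where
  "hom_coords (Fin w) = vector [w, 1]"
| "hom_coords Infty = vector [1, 0]"

lemma hom_coords_unique:
  assumes "k *s hom_coords u = l *s hom_coords v" "k \<noteq> 0" "l \<noteq> 0"
  shows "u = v"
  using assms by (cases u; cases v) (auto simp: vec_eq_iff forall_2)

text \<open>In homogeneous coordinates a Moebius transformation is linear up to a nonzero factor, so
  the special cases at infinity are treated only here.\<close>

lemma moebius_map_hom_coords:
  assumes "det S = 1"
  obtains k where "k \<noteq> 0" "S *v hom_coords w = k *s hom_coords (moebius_map S w)"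
proof (cases w)
  case (Fin u)
  show thesis
  proof (cases "S$2$1 * u + S$2$2 = 0")
    case True
    \<comment> \<open>Numerator and denominator cannot both vanish, as \<open>(u, 1)\<close> would
      lie in the kernel of \<open>S\<close>.\<close>
    have "S$1$1 * u + S$1$2 \<noteq> 0"
    proof
      assume "S$1$1 * u + S$1$2 = 0"
      with True assms show False unfolding det_2 by algebra
    qed
    with True show thesis
      by (intro that[of "S$1$1 * u + S$1$2"])
         (simp_all add: Fin vec_eq_iff forall_2 matrix_vector_mult_2_nth)
  next
    case False
    then show thesis
      by (intro that[of "S$2$1 * u + S$2$2"])
         (simp_all add: Fin vec_eq_iff forall_2 matrix_vector_mult_2_nth moebius_def
           flip: add_divide_distrib distrib_right)
  qed
next
  case Infty
  show thesis
  proof (cases "S$2$1 = 0")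
    case True
    then have "S$1$1 \<noteq> 0" using assms by (auto simp: det_2)
    with True show thesis
      by (intro that[of "S$1$1"]) (simp_all add: Infty vec_eq_iff forall_2 matrix_vector_mult_2_nth)
  next
    case False
    then show thesis
      by (intro that[of "S$2$1"]) (simp_all add: Infty vec_eq_iff forall_2 matrix_vector_mult_2_nth)
  qed
qed

lemma moebius_map_mult:
  assumes "det A = 1" "det B = 1"
  shows "moebius_map (A ** B) w = moebius_map A (moebius_map B w)"
proof -
  obtain k where k: "k \<noteq> 0" "B *v hom_coords w = k *s hom_coords (moebius_map B w)"
    using moebius_map_hom_coords[OF assms(2)] .
  obtain l where l: "l \<noteq> 0" "A *v hom_coords (moebius_map B w) = l *s hom_coords (moebius_map A (moebius_map B w))"
    using moebius_map_hom_coords[OF assms(1)] .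
  obtain m where m: "m \<noteq> 0" "(A ** B) *v hom_coords w = m *s hom_coords (moebius_map (A ** B) w)"
    using moebius_map_hom_coords[of "A ** B"] assms by (metis det_mul mult_1)
  have "m *s hom_coords (moebius_map (A ** B) w) = (k * l) *s hom_coords (moebius_map A (moebius_map B w))"
    by (simp flip: m(2) matrix_vector_mul_assoc add: k(2) l(2) vector_scalar_commute vector_smult_assoc)
  then show ?thesis
    using k l m by (auto intro: hom_coords_unique)
qed

lemma moebius_map_one: "moebius_map (mat 1) w = w"
  by (cases w) (simp_all add: mat_def moebius_def)

lemma moebius_map_uminus: "moebius_map (- A) w = moebius_map A w"
proof (cases w)
  case (Fin u)
  have "(- A)$i$1 * u + (- A)$i$2 = - (A$i$1 * u + A$i$2)" for i
    by simp
  then show ?thesis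
    by (simp only: Fin moebius_map.simps moebius_def minus_divide_divide neg_equal_0_iff_equal)
qed simp

text \<open>Equal maps make \<open>A\<close> and \<open>B\<close> proportional on each coordinate
  vector. Comparing the factors at infinity, 0 and 1 shows that \<open>A\<close> is a scalar
  multiple of \<open>B\<close>, and the determinants force the scalar to be a sign.\<close>

lemma moebius_map_eq_iff:
  assumes A: "det A = 1" and B: "det B = 1"
  shows "moebius_map A = moebius_map B \<longleftrightarrow> A = B \<or> A = - B"
proof
  assume eq: "moebius_map A = moebius_map B"
  have "\<exists>c. A *v hom_coords w = c *s (B *v hom_coords w)" for w
  proof -
    obtain k where k: "k \<noteq> 0" "A *v hom_coords w = k *s hom_coords (moebius_map A w)"
      using moebius_map_hom_coords[OF A] .
    obtain l where l: "l \<noteq> 0" "B *v hom_coords w = l *s hom_coords (moebius_map B w)"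
      using moebius_map_hom_coords[OF B] .
    have "A *v hom_coords w = (k / l) *s (B *v hom_coords w)"
      using l(1) by (simp add: k(2) l(2) eq vector_smult_assoc)
    then show ?thesis by blast
  qed
  then obtain c where c: "A *v hom_coords w = c w *s (B *v hom_coords w)" for w
    by metis
  have inf: "A$i$1 = c Infty * B$i$1" for i
    using arg_cong[OF c[of Infty], of "\<lambda>v. v $ i"] by (simp add: matrix_vector_mult_2_nth)
  have zero: "A$i$2 = c (Fin 0) * B$i$2" for i
    using arg_cong[OF c[of "Fin 0"], of "\<lambda>v. v $ i"] by (simp add: matrix_vector_mult_2_nth)
  have one: "A$i$1 + A$i$2 = c (Fin 1) * (B$i$1 + B$i$2)" for i
    using arg_cong[OF c[of "Fin 1"], of "\<lambda>v. v $ i"] by (simp add: matrix_vector_mult_2_nth)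
  have lin: "(c Infty - c (Fin 1)) * B$i$1 + (c (Fin 0) - c (Fin 1)) * B$i$2 = 0" for i
    using one[of i] by (simp add: inf zero algebra_simps)
  \<comment> \<open>The columns of \<open>B\<close> are linearly independent, so both coefficients
    in \<open>lin\<close> vanish.\<close>
  have "c Infty = c (Fin 1)" "c (Fin 0) = c (Fin 1)"
    using lin[of 1] lin[of 2] B unfolding det_2 by algebra+
  then have nth: "A$i$1 = c Infty * B$i$1" "A$i$2 = c Infty * B$i$2" for i
    using inf zero by simp_all
  have "c Infty * c Infty * det B = det A"
    by (simp add: det_2 nth algebra_simps)
  then have "c Infty = 1 \<or> c Infty = - 1"
    using A B by (simp add: square_eq_1_iff)
  then show "A = B \<or> A = - B"
    by (auto simp: mat2_eq_iff nth)
qed (auto simp: fun_eq_iff moebius_map_uminus)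

section \<open>Equivalence of hyperplanes\<close>

definition outer :: "complex ^ 2 \<Rightarrow> complex ^ 2 \<Rightarrow> complex ^ 2 ^ 2"
  where "outer v w = (\<chi> i j. v $ i * w $ j)"

lemma outer_nth [simp]: "outer v w $ i $ j = v $ i * w $ j"
  by (simp add: outer_def)

text \<open>This is the Segre embedding, uniform in the four cases of \<open>Psi_inv\<close>. The
  representatives chosen there are twice the vectors of the rank one matrices, hence the factor
  2.\<close>

lemma Psi_inv_outer: "Psi_inv (u, v) = cproj (unherm (outer (hom_coords u) (hom_coords v)))"
  by (cases u; cases v; simp; rule sym; rule cproj_eqI[of 2]) (simp_all add: unherm_def field_simps)

lemma spin_act_outer:
  "spin_act T (unherm (outer v w)) = unherm (outer (T *v v) (cnj_matrix T *v w))"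
  unfolding spin_act_def herm_unherm
  by (rule arg_cong[of _ _ unherm])
     (simp add: mat2_eq_iff matrix_mult_2_nth matrix_vector_mult_2_nth algebra_simps)

lemma spin_act_cproj: "spin_act T ` cproj z = cproj (spin_act T z)"
  by (force simp: cproj_def spin_act_scale)

lemma spin_act_Psi_inv:
  assumes "det T = 1"
  shows "spin_act T ` Psi_inv (u, v) = Psi_inv (moebius_map T u, moebius_map (cnj_matrix T) v)"
proof -
  have T': "det (cnj_matrix T) = 1" using assms by (simp add: det_cnj_matrix_2)
  obtain k where k: "k \<noteq> 0" "T *v hom_coords u = k *s hom_coords (moebius_map T u)"
    using moebius_map_hom_coords[OF assms] .
  obtain l where l: "l \<noteq> 0" "cnj_matrix T *v hom_coords v = l *s hom_coords (moebius_map (cnj_matrix T) v)"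
    using moebius_map_hom_coords[OF T'] .
  \<comment> \<open>Rescaling either spinor changes only the representative of the projective
    point.\<close>
  have "unherm (outer (k *s x) (l *s y)) = (k * l) *s unherm (outer x y)" for x y
    by (simp add: unherm_def vec4_eq_iff field_simps)
  then have "cproj (unherm (outer (k *s x) (l *s y))) = cproj (unherm (outer x y))" for x y
    using k(1) l(1) by (metis cproj_eq_iff mult_eq_0_iff)
  then show ?thesis
    by (simp only: Psi_inv_outer spin_act_cproj spin_act_outer k(2) l(2))
qed

lemma act_lorentz_graph:
  assumes "det T = 1"
  shows "act (lorentz T) (Psi_inv ` graph_of f)
    = Psi_inv ` range (\<lambda>w. (moebius_map T w, moebius_map (cnj_matrix T) (f w)))"
proof -
  have "complexify (lorentz T) = spin_act T" by (simp add: fun_eq_iff complexify_lorentz)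
  then show ?thesis
    by (simp add: act_def graph_of_def image_image spin_act_Psi_inv[OF assms])
qed

lemma surj_moebius_map:
  assumes "det T = 1"
  shows "surj (moebius_map T)"
proof (rule surjI)
  fix w
  show "moebius_map T (moebius_map (matrix_inv T) w) = w"
    using assms by (simp add: matrix_inv_SL2C moebius_map_one flip: moebius_map_mult)
qed

text \<open>The image of a graph comes with its first coordinate moved by \<open>g\<close>.
  Surjectivity of \<open>g\<close> ensures that every point of the sphere still occurs as a first
  coordinate.\<close>

lemma reparametrized_graph_eq_iff:
  assumes "surj g"
  shows "range (\<lambda>w. (g w, h w)) = graph_of f \<longleftrightarrow> (\<forall>w. f (g w) = h w)"
proof
  assume "range (\<lambda>w. (g w, h w)) = graph_of f"
  then have "(g w, h w) \<in> graph_of f" for w by blast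
  then show "\<forall>w. f (g w) = h w" by (simp add: graph_of_def image_iff)
next
  assume "\<forall>w. f (g w) = h w"
  then have "range (\<lambda>w. (g w, h w)) = (\<lambda>w. (w, f w)) ` range g"
    by (simp add: image_image)
  then show "range (\<lambda>w. (g w, h w)) = graph_of f"
    using assms by (simp add: graph_of_def)
qed

text \<open>Equality of the graphs is an intertwining relation of Moebius transformations, with
  \<open>T\<close> kept on the left so that no inverse enters; matrices are then recovered up to
  sign.\<close>

lemma act_lorentz_graph_moebius_iff:
  assumes "det T = 1" "det S1 = 1" "det S2 = 1"
  shows "act (lorentz T) (Psi_inv ` graph_of (moebius_map S1)) = Psi_inv ` graph_of (moebius_map S2)
    \<longleftrightarrow> S2 ** T = cnj_matrix T ** S1 \<or> S2 ** T = - (cnj_matrix T ** S1)"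
proof -
  have T': "det (cnj_matrix T) = 1" using assms by (simp add: det_cnj_matrix_2)
  have "act (lorentz T) (Psi_inv ` graph_of (moebius_map S1)) = Psi_inv ` graph_of (moebius_map S2)
    \<longleftrightarrow> (\<forall>w. moebius_map S2 (moebius_map T w) = moebius_map (cnj_matrix T) (moebius_map S1 w))"
    by (simp only: act_lorentz_graph[OF assms(1)] inj_image_eq_iff[OF inj_Psi_inv]
        reparametrized_graph_eq_iff[OF surj_moebius_map[OF assms(1)]])
  also have "\<dots> \<longleftrightarrow> moebius_map (S2 ** T) = moebius_map (cnj_matrix T ** S1)"
    by (simp add: fun_eq_iff moebius_map_mult assms T')
  also have "\<dots> \<longleftrightarrow> S2 ** T = cnj_matrix T ** S1 \<or> S2 ** T = - (cnj_matrix T ** S1)"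
    by (rule moebius_map_eq_iff) (simp_all add: det_mul assms T')
  finally show ?thesis .
qed

text \<open>A hyperplane lies in the range of \<open>Psi_inv\<close>, where \<open>Psi\<close> is a
  genuine inverse, so it can be recovered from its image.\<close>

lemma hyperplane_eq_Psi_inv_image:
  assumes "is_hyperplane H"
  shows "H = Psi_inv ` Psi ` H"
proof -
  have "H \<subseteq> range Psi_inv"
    using assms by (auto simp: range_Psi_inv Q11_def is_hyperplane_def hyperplane_of_def)
  then show ?thesis
    by (simp add: Psi_def image_inv_into_cancel)
qed

theorem proposition2p6:
  fixes H1 H2 :: "(complex ^ 4) set set" and S1 S2 :: "complex ^ 2 ^ 2"
  assumes "is_hyperplane H1" and "is_hyperplane H2"
    and "S1 \<in> SL2C" and "S2 \<in> SL2C"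
    and "Psi ` H1 = graph_of (moebius_map S1)"
    and "Psi ` H2 = graph_of (moebius_map S2)"
  shows "equivalent H1 H2 \<longleftrightarrow>
    (\<exists>T\<in>SL2C. S2 = cnj_matrix T ** S1 ** matrix_inv T \<or>
              S2 = - (cnj_matrix T ** S1 ** matrix_inv T))"
proof -
  have H: "H1 = Psi_inv ` graph_of (moebius_map S1)" "H2 = Psi_inv ` graph_of (moebius_map S2)"
    using hyperplane_eq_Psi_inv_image assms by metis+
  \<comment> \<open>Surjectivity of \<open>lorentz\<close> onto \<open>SO_plus_31\<close> replaces
    the isometries by matrices in \<open>SL2C\<close>.\<close>
  have "equivalent H1 H2 \<longleftrightarrow> (\<exists>T\<in>SL2C. act (lorentz T) H1 = H2)"
    unfolding equivalent_def SL2C_def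
    by (auto intro: lorentz_in_SO_plus elim!: SO_plus_is_lorentz)
  also have "\<dots> \<longleftrightarrow> (\<exists>T\<in>SL2C. S2 ** T = cnj_matrix T ** S1 \<or> S2 ** T = - (cnj_matrix T ** S1))"
    unfolding H using assms(3,4) act_lorentz_graph_moebius_iff by (auto simp: SL2C_def)
  also have "\<dots> \<longleftrightarrow> (\<exists>T\<in>SL2C. S2 = cnj_matrix T ** S1 ** matrix_inv T \<or>
              S2 = - (cnj_matrix T ** S1 ** matrix_inv T))"
  proof (rule bex_cong[OF refl])
    fix T :: "complex ^ 2 ^ 2" assume "T \<in> SL2C"
    then have inv: "T ** matrix_inv T = mat 1" "matrix_inv T ** T = mat 1"
      by (simp_all add: SL2C_def matrix_inv_SL2C)
    have uminus: "(- A) ** B = - (A ** B)" for A B :: "complex ^ 2 ^ 2"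
      by (simp add: mat2_eq_iff matrix_mult_2_nth)
    have "S2 ** T = A \<longleftrightarrow> S2 = A ** matrix_inv T" for A
      using inv by (metis matrix_mul_assoc matrix_mul_rid)
    then show "S2 ** T = cnj_matrix T ** S1 \<or> S2 ** T = - (cnj_matrix T ** S1) \<longleftrightarrow>
        S2 = cnj_matrix T ** S1 ** matrix_inv T \<or> S2 = - (cnj_matrix T ** S1 ** matrix_inv T)"
      by (simp add: uminus)
  qed
  finally show ?thesis .
qed

end
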